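(* Let $\psi(q)=\sum_{n=1}^\infty \frac{q^{n^2}}{(q;q^2)_n}$ be Ramanujan's third order mock theta function, and for $n\ge 1$ let $p_{do}(n)$ denote the number of partitions of $n$ into distinct parts with the smallest part being odd. Then \[ 2(-q;q)_\infty\,\psi(-q)=-\sum_{n=1}^\infty p_{do}(n)q^n+\sum_{k=1}^\infty (-1)^k q^{k^2}. \]
   Context: Notation: $(a;q)_n=(1-a)(1-aq)\cdots(1-aq^{n-1})$ and $(a;q)_\infty=\prod_{n\ge 0}(1-aq^n)$, $|q|<1$ (equivalently, identities of formal power series in $q$). *)

theory Defs
  imports "HOL-Analysis.Analysis" "HOL-Library.Multiset"
begin

definition qpoch :: "complex \<Rightarrow> complex \<Rightarrow> nat \<Rightarrow> complex" where
  "qpoch a q n = (\<Prod>k<n. 1 - a * q ^ k)"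

definition qpoch_inf :: "complex \<Rightarrow> complex \<Rightarrow> complex" where
  "qpoch_inf a q = (\<Prod>k. 1 - a * q ^ k)"

text \<open>The series of the third order mock theta function starts at exponent \<open>1\<close>, hence the
  shift of the summation index by one.\<close>

definition mock_psi :: "complex \<Rightarrow> complex" where
  "mock_psi q = (\<Sum>n. q ^ ((Suc n)\<^sup>2) / qpoch q (q\<^sup>2) (Suc n))"

text \<open>A partition of \<open>n\<close> is a finite multiset of positive integers (its parts) with sum \<open>n\<close>.\<close>

definition is_partition :: "nat multiset \<Rightarrow> nat \<Rightarrow> bool" where
  "is_partition P n \<longleftrightarrow> 0 \<notin># P \<and> sum_mset P = n"

text \<open>The empty partition has no smallest part and is excluded; this only matters for \<open>n = 0\<close>.\<close>

definition p_do :: "nat \<Rightarrow> nat" where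
  "p_do n = card {P. is_partition P n \<and> (\<forall>x. count P x \<le> 1) \<and> P \<noteq> {#} \<and> odd (Min (set_mset P))}"

end

theory Submission
  imports Defs
begin

text \<open>
  Put \<open>Q = q\<^sup>2\<close>, let \<open>(a)\<^sub>\<infinity>\<close> and \<open>(a)\<^sub>m\<close> stand for \<open>(a;Q)\<^sub>\<infinity>\<close> and \<open>(a;Q)\<^sub>m\<close>, and consider
  \<open>V(z) = \<Sum>\<^sub>m z Q\<^sup>m (-z Q\<^bsup>m+1\<^esup>)\<^sub>\<infinity> / (-Q)\<^sub>m\<close>.
  Sorting the partitions counted by \<open>p_do\<close> by their smallest part \<open>2 m + 1\<close>, and splitting the
  product over the remaining parts by parity, identifies their generating function with
  \<open>(-Q)\<^sub>\<infinity> V(q)\<close>.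
  A telescoping sum gives \<open>V(z) + z V(z Q) = 2 z (-z Q)\<^sub>\<infinity> - z / (-Q)\<^sub>\<infinity>\<close>, and iterating this from
  \<open>z = q\<close> expands \<open>V(q)\<close> into two alternating series with exponents \<open>k\<^sup>2\<close>: the first is
  \<open>-2 (-q)\<^sub>\<infinity> \<psi>(-q)\<close>, the second is \<open>\<Sum>\<^sub>k (-1)\<^sup>k q\<^bsup>k\<^sup>2\<^esup> / (-Q)\<^sub>\<infinity>\<close>.
\<close>

section \<open>Finite and infinite q-Pochhammer products: splitting, limits and bounds\<close>

lemma qpoch_add: "qpoch a q (m + n) = qpoch a q m * qpoch (a * q ^ m) q n"
  by (induction n) (simp_all add: qpoch_def power_add mult_ac)

lemma qpoch_double: "qpoch a q (2 * n) = qpoch a (q\<^sup>2) n * qpoch (a * q) (q\<^sup>2) n"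
proof (induction n)
  case (Suc n)
  have "(q\<^sup>2) ^ n = q ^ (2 * n)"
    by (simp add: power_mult)
  with Suc show ?case
    by (simp add: qpoch_def mult_ac)
qed (simp add: qpoch_def)

lemma qpoch_factor_nonzero:
  fixes a q :: complex
  assumes "norm q < 1" and "norm a < 1"
  shows "1 - a * q ^ k \<noteq> 0"
proof
  assume "1 - a * q ^ k = 0"
  then have "a * q ^ k = 1"
    by simp
  then have "norm (a * q ^ k) = 1"
    by (simp only: norm_one)
  moreover have "norm (a * q ^ k) \<le> norm a * 1"
    unfolding norm_mult norm_power using assms by (intro mult_left_mono power_le_one) auto
  ultimately show False
    using assms by simp
qed

lemma qpoch_nonzero: "norm q < 1 \<Longrightarrow> norm a < 1 \<Longrightarrow> qpoch a q n \<noteq> 0"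
  unfolding qpoch_def using qpoch_factor_nonzero by (subst prod_zero_iff) blast+

lemma convergent_prod_qpoch:
  fixes a q :: complex
  assumes "norm q < 1"
  shows "convergent_prod (\<lambda>k. 1 - a * q ^ k)"
proof -
  have "summable (\<lambda>k. norm a * norm q ^ k)"
    using assms by (intro summable_mult summable_geometric) simp
  then show ?thesis
    by (intro abs_convergent_prod_imp_convergent_prod)
      (simp add: abs_convergent_prod_conv_summable norm_mult norm_power)
qed

lemma qpoch_tendsto:
  assumes "norm q < 1"
  shows "(\<lambda>n. qpoch a q n) \<longlonglongrightarrow> qpoch_inf a q"
proof -
  \<comment> \<open>The limit theorem for infinite products runs over the indices up to and
    including \<open>n\<close>, that is over \<open>Suc n\<close> factors.\<close>
  have "(\<lambda>n. qpoch a q (Suc n)) \<longlonglongrightarrow> qpoch_inf a q"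
    using convergent_prod_LIMSEQ [OF convergent_prod_qpoch [OF assms]]
    by (simp add: qpoch_def qpoch_inf_def lessThan_Suc_atMost)
  then show ?thesis
    by (simp only: filterlim_sequentially_Suc)
qed

lemma qpoch_inf_nonzero: "norm q < 1 \<Longrightarrow> norm a < 1 \<Longrightarrow> qpoch_inf a q \<noteq> 0"
  unfolding qpoch_inf_def by (intro prodinf_nonzero convergent_prod_qpoch qpoch_factor_nonzero)

lemma qpoch_inf_split:
  assumes "norm q < 1"
  shows "qpoch_inf a q = qpoch a q n * qpoch_inf (a * q ^ n) q"
proof (rule LIMSEQ_unique)
  show "(\<lambda>m. qpoch a q (n + m)) \<longlonglongrightarrow> qpoch_inf a q"
    using LIMSEQ_ignore_initial_segment [OF qpoch_tendsto [OF assms], of a n]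
    by (simp add: add.commute)
  show "(\<lambda>m. qpoch a q (n + m)) \<longlonglongrightarrow> qpoch a q n * qpoch_inf (a * q ^ n) q"
    unfolding qpoch_add by (intro tendsto_intros qpoch_tendsto assms)
qed

lemma qpoch_inf_Suc:
  assumes "norm q < 1"
  shows "qpoch_inf a q = (1 - a) * qpoch_inf (a * q) q"
  using qpoch_inf_split [OF assms, of a 1] by (simp add: qpoch_def)

text \<open>The factors are sorted by the parity of the exponent of \<open>q\<close>; the infinite
  case is the limit of the finite one along products of even length.\<close>

lemma qpoch_inf_double:
  assumes "norm q < 1"
  shows "qpoch_inf a q = qpoch_inf a (q\<^sup>2) * qpoch_inf (a * q) (q\<^sup>2)"
proof (rule LIMSEQ_unique)
  have "norm (q\<^sup>2) < 1"
    using assms by (simp add: norm_power power_less_one_iff)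
  then show "(\<lambda>n. qpoch a q (2 * n)) \<longlonglongrightarrow> qpoch_inf a (q\<^sup>2) * qpoch_inf (a * q) (q\<^sup>2)"
    unfolding qpoch_double by (intro tendsto_intros qpoch_tendsto)
  show "(\<lambda>n. qpoch a q (2 * n)) \<longlonglongrightarrow> qpoch_inf a q"
    by (rule filterlim_compose [OF qpoch_tendsto [OF assms]])
      (auto intro!: filterlim_subseq simp: strict_mono_def)
qed

text \<open>The tail is the full product divided by \<open>qpoch a q n\<close>. The full product is
  nonzero because \<open>norm a < 1\<close>, so this quotient tends to 1.\<close>

lemma qpoch_inf_tendsto_1:
  assumes "norm q < 1" and "norm a < 1"
  shows "(\<lambda>n. qpoch_inf (a * q ^ n) q) \<longlonglongrightarrow> 1"
proof -
  have "(\<lambda>n. qpoch_inf a q / qpoch a q n) \<longlonglongrightarrow> qpoch_inf a q / qpoch_inf a q"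
    using assms by (intro tendsto_intros qpoch_tendsto qpoch_inf_nonzero)
  moreover have "qpoch_inf a q / qpoch a q n = qpoch_inf (a * q ^ n) q" for n
    using qpoch_inf_split [OF assms(1), of a n] qpoch_nonzero [OF assms, of n] by simp
  ultimately show ?thesis
    using qpoch_inf_nonzero [OF assms] by simp
qed

lemma Bseq_qpoch_inf_shift:
  assumes "norm q < 1" and "norm a < 1"
  obtains C where "C > 0" and "\<And>n. norm (qpoch_inf (a * q ^ n) q) \<le> C"
  using convergent_imp_Bseq [OF convergentI [OF qpoch_inf_tendsto_1 [OF assms]]]
  by (elim BseqE) blast

lemma Bseq_inverse_qpoch:
  assumes "norm q < 1" and "norm a < 1"
  obtains C where "C > 0" and "\<And>n. norm (1 / qpoch a q n) \<le> C"
proof -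
  have "(\<lambda>n. 1 / qpoch a q n) \<longlonglongrightarrow> 1 / qpoch_inf a q"
    using assms by (intro tendsto_intros qpoch_tendsto qpoch_inf_nonzero)
  then show ?thesis
    using that by (elim BseqE [OF convergent_imp_Bseq [OF convergentI]]) blast
qed

section \<open>The series \<open>V(z)\<close>, its functional equation and the expansion of
  \<open>V(q)\<close>\<close>

definition odd_min_series :: "complex \<Rightarrow> complex \<Rightarrow> complex" where
  "odd_min_series Q z = (\<Sum>m. z * Q ^ m * qpoch_inf (- (z * Q ^ Suc m)) Q / qpoch (- Q) Q m)"

text \<open>The shifted tails and the reciprocals of the finite products converge, hence are
  bounded, so one \<open>K\<close> serves all \<open>n\<close> and \<open>m\<close>. The case
  \<open>n = 0\<close> gives summability; uniformity in \<open>n\<close> bounds all values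
  \<open>V(z Q^n)\<close> at once, which later kills the remainder of the iteration.\<close>

lemma odd_min_series_term_bound:
  assumes Q: "norm Q < 1" and z: "norm z < 1"
  obtains K where "\<And>n m. norm ((z * Q ^ n) * Q ^ m * qpoch_inf (- (z * Q ^ n * Q ^ Suc m)) Q /
    qpoch (- Q) Q m) \<le> norm Q ^ m * K"
proof -
  obtain C where C: "C > 0" "\<And>n. norm (qpoch_inf (- z * Q ^ n) Q) \<le> C"
    using Bseq_qpoch_inf_shift [OF Q, of "- z"] z unfolding norm_minus_cancel by blast
  obtain D where D: "D > 0" "\<And>n. norm (1 / qpoch (- Q) Q n) \<le> D"
    using Bseq_inverse_qpoch [OF Q, of "- Q"] Q unfolding norm_minus_cancel by blast
  show ?thesis
  proof (rule that)
    fix n m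
    let ?g = "qpoch_inf (- (z * Q ^ n * Q ^ Suc m)) Q" and ?e = "1 / qpoch (- Q) Q m"
    have zQ: "norm (z * Q ^ n) \<le> 1 * 1"
      unfolding norm_mult norm_power using Q z by (intro mult_mono power_le_one) auto
    \<comment> \<open>The two shifts merge into the single index \<open>n + Suc m\<close>, so
      \<open>C\<close> depends on neither.\<close>
    have g: "norm ?g \<le> C"
      using C(2) [of "n + Suc m"] by (simp add: power_add mult_ac)
    have "norm ((z * Q ^ n) * Q ^ m * ?g / qpoch (- Q) Q m) =
        norm (z * Q ^ n) * (norm Q ^ m * (norm ?g * norm ?e))"
      by (simp add: norm_mult norm_power norm_divide)
    also have "\<dots> \<le> 1 * (norm Q ^ m * (C * D))"
      using zQ C(1) D
      by (intro mult_mono [OF _ mult_left_mono [OF mult_mono [OF g D(2)]]]) auto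
    finally show "norm ((z * Q ^ n) * Q ^ m * ?g / qpoch (- Q) Q m) \<le> norm Q ^ m * (C * D)"
      by simp
  qed
qed

lemma summable_odd_min_series:
  assumes Q: "norm Q < 1" and z: "norm z < 1"
  shows "summable (\<lambda>m. z * Q ^ m * qpoch_inf (- (z * Q ^ Suc m)) Q / qpoch (- Q) Q m)"
proof -
  obtain K where K: "\<And>n m. norm ((z * Q ^ n) * Q ^ m * qpoch_inf (- (z * Q ^ n * Q ^ Suc m)) Q /
      qpoch (- Q) Q m) \<le> norm Q ^ m * K"
    using odd_min_series_term_bound [OF Q z] by blast
  show ?thesis
  proof (rule summable_comparison_test')
    show "summable (\<lambda>m. norm Q ^ m * K)"
      using Q by (intro summable_mult2 summable_geometric) simp
  qed (use K [of 0] in simp)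
qed

lemma odd_min_series_bounded:
  assumes Q: "norm Q < 1" and z: "norm z < 1"
  obtains C where "\<And>n. norm (odd_min_series Q (z * Q ^ n)) \<le> C"
proof -
  obtain K where K: "\<And>n m. norm ((z * Q ^ n) * Q ^ m * qpoch_inf (- (z * Q ^ n * Q ^ Suc m)) Q /
      qpoch (- Q) Q m) \<le> norm Q ^ m * K"
    using odd_min_series_term_bound [OF Q z] by blast
  have geo: "summable (\<lambda>m. norm Q ^ m * K)"
    using Q by (intro summable_mult2 summable_geometric) simp
  show ?thesis
  proof (rule that)
    fix n
    have norm_summable: "summable (\<lambda>m. norm ((z * Q ^ n) * Q ^ m *
        qpoch_inf (- (z * Q ^ n * Q ^ Suc m)) Q / qpoch (- Q) Q m))"
      by (rule summable_comparison_test' [OF geo]) (unfold real_norm_def abs_norm_cancel, rule K)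
    show "norm (odd_min_series Q (z * Q ^ n)) \<le> (\<Sum>m. norm Q ^ m * K)"
      unfolding odd_min_series_def
      by (rule order_trans [OF summable_norm [OF norm_summable] suminf_le [OF K norm_summable geo]])
  qed
qed

text \<open>With \<open>g\<close>, \<open>E\<close>, \<open>h\<close> as in the proof, the
  \<open>m\<close>-th terms of the two series add up to
  \<open>z ((1 + Q^m) g m - g (Suc m)) / E m\<close>, which is \<open>h m - h (Suc m)\<close>. The
  right-hand side is \<open>h 0\<close> minus the limit of \<open>h\<close>.\<close>

lemma odd_min_series_rec:
  assumes Q: "norm Q < 1" and z: "norm z < 1"
  shows "odd_min_series Q z + z * odd_min_series Q (z * Q) =
    2 * z * qpoch_inf (- (z * Q)) Q - z / qpoch_inf (- Q) Q"
proof -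
  define g where "g m = qpoch_inf (- (z * Q ^ Suc m)) Q" for m
  define E where "E m = qpoch (- Q) Q m" for m
  \<comment> \<open>For positive \<open>m\<close> the factor \<open>1 + Q ^ m\<close> cancels the
    last factor of \<open>E m\<close>; at \<open>m = 0\<close> it equals 2, which is the origin of
    the coefficient 2.\<close>
  define h where "h m = z * (1 + Q ^ m) * g m / E m" for m
  have E: "E m \<noteq> 0" for m
    using qpoch_nonzero [OF Q, of "- Q"] Q by (simp add: E_def)
  have E_Suc: "E (Suc m) = E m * (1 + Q ^ Suc m)" for m
    by (simp add: E_def qpoch_def)
  then have nz: "1 + Q ^ Suc m \<noteq> 0" for m
    using E [of "Suc m"] by auto
  have g_rec: "g m = (1 + z * Q ^ Suc m) * g (Suc m)" for m
    using qpoch_inf_Suc [OF Q, of "- (z * Q ^ Suc m)"] by (simp add: g_def mult_ac)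
  have g_lim: "g \<longlonglongrightarrow> 1"
    using LIMSEQ_Suc [OF qpoch_inf_tendsto_1 [OF Q, of "- z"]] z by (simp add: g_def [abs_def])
  have E_lim: "E \<longlonglongrightarrow> qpoch_inf (- Q) Q"
    unfolding E_def [abs_def] by (rule qpoch_tendsto [OF Q])
  have E_inf: "qpoch_inf (- Q) Q \<noteq> 0"
    using qpoch_inf_nonzero [OF Q, of "- Q"] Q by simp
  have h_Suc: "h (Suc m) = z * g (Suc m) / E m" for m
  proof -
    have "z * w * x / (e * w) = z * x / e" if "w \<noteq> 0" for w x e :: complex
      using that by simp
    from this [OF nz [of m]] show ?thesis
      unfolding h_def E_Suc .
  qed
  have "(\<lambda>m. h (Suc m)) \<longlonglongrightarrow> z * 1 / qpoch_inf (- Q) Q"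
    unfolding h_Suc by (intro tendsto_intros LIMSEQ_Suc g_lim E_lim E_inf)
  then have "h \<longlonglongrightarrow> z / qpoch_inf (- Q) Q"
    by (simp only: filterlim_sequentially_Suc mult_1_right)
  then have "(\<lambda>m. h m - h (Suc m)) sums (h 0 - z / qpoch_inf (- Q) Q)"
    by (rule telescope_sums')
  then have rhs: "(\<Sum>m. h m - h (Suc m)) = 2 * z * qpoch_inf (- (z * Q)) Q - z / qpoch_inf (- Q) Q"
    by (simp add: sums_iff h_def g_def E_def qpoch_def)
  have s0: "summable (\<lambda>m. z * Q ^ m * g m / E m)"
    using summable_odd_min_series [OF Q z] by (simp add: g_def E_def)
  have "norm z * norm Q \<le> 1 * norm Q"
    using z by (intro mult_right_mono) auto
  with Q have "norm (z * Q) < 1"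
    by (simp add: norm_mult)
  from summable_odd_min_series [OF Q this]
  have s1: "summable (\<lambda>m. z * Q * Q ^ m * g (Suc m) / E m)"
    by (simp add: g_def E_def mult_ac)
  have "odd_min_series Q z + z * odd_min_series Q (z * Q) =
      (\<Sum>m. z * Q ^ m * g m / E m) + z * (\<Sum>m. z * Q * Q ^ m * g (Suc m) / E m)"
    by (simp add: odd_min_series_def g_def E_def mult_ac)
  also have "\<dots> = (\<Sum>m. z * Q ^ m * g m / E m + z * (z * Q * Q ^ m * g (Suc m) / E m))"
    unfolding suminf_mult [OF s1, symmetric] by (rule suminf_add [OF s0 summable_mult [OF s1]])
  also have "(\<lambda>m. z * Q ^ m * g m / E m + z * (z * Q * Q ^ m * g (Suc m) / E m)) = (\<lambda>m. h m - h (Suc m))"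
  proof
    fix m
    \<comment> \<open>By \<open>g_rec\<close>, \<open>z * Q ^ Suc m * g (Suc m)\<close> is the
      difference \<open>g m - g (Suc m)\<close>.\<close>
    have "z * (z * Q * Q ^ m * g (Suc m) / E m) = z * (g m - g (Suc m)) / E m"
      unfolding g_rec [of m] by (simp add: algebra_simps)
    then show "z * Q ^ m * g m / E m + z * (z * Q * Q ^ m * g (Suc m) / E m) = h m - h (Suc m)"
      by (subst h_Suc) (simp add: h_def algebra_simps add_divide_distrib diff_divide_distrib)
  qed
  finally show ?thesis
    using rhs by simp
qed

lemma odd_min_series_expansion:
  fixes q :: complex
  assumes q: "norm q < 1"
  shows "(\<lambda>n. (- 1) ^ Suc n * q ^ (Suc n)\<^sup>2 *
      (1 / qpoch_inf (- q\<^sup>2) (q\<^sup>2) - 2 * qpoch_inf (- (q * (q\<^sup>2) ^ Suc n)) (q\<^sup>2)))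
    sums odd_min_series (q\<^sup>2) q"
proof -
  define Q where "Q = q\<^sup>2"
  have Q: "norm Q < 1"
    using q by (simp add: Q_def norm_power power_less_one_iff)
  define V where "V n = odd_min_series Q (q * Q ^ n)" for n
  define s where "s n = (- 1) ^ Suc n * q ^ (Suc n)\<^sup>2 *
      (1 / qpoch_inf (- Q) Q - 2 * qpoch_inf (- (q * Q ^ Suc n)) Q)" for n
  \<comment> \<open>\<open>r n\<close> is the remainder after \<open>n\<close> applications of the
    functional equation, starting from \<open>r 0 = V 0\<close>; each application splits off the
    term \<open>s n\<close>.\<close>
  define r where "r n = (- 1) ^ n * q ^ n\<^sup>2 * V n" for n
  obtain C where C: "\<And>n. norm (V n) \<le> C"
    using odd_min_series_bounded [OF Q q] unfolding V_def by blast
  have "r \<longlonglongrightarrow> 0"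
  proof (rule Lim_null_comparison)
    \<comment> \<open>The values \<open>V n\<close> are uniformly bounded and
      \<open>n\<^sup>2 \<ge> n\<close>, so a geometric majorant suffices.\<close>
    show "\<forall>\<^sub>F n in sequentially. norm (r n) \<le> norm q ^ n * C"
    proof (rule always_eventually, intro allI)
      fix n :: nat
      have "norm (r n) = norm q ^ n\<^sup>2 * norm (V n)"
        by (simp add: r_def norm_mult norm_power)
      also have "\<dots> \<le> norm q ^ n * C"
        using q C by (intro mult_mono power_decreasing) (auto simp: power2_eq_square)
      finally show "norm (r n) \<le> norm q ^ n * C" .
    qed
    show "(\<lambda>n. norm q ^ n * C) \<longlonglongrightarrow> 0"
      using q by (intro tendsto_mult_left_zero LIMSEQ_power_zero) simp
  qed
  then have "(\<lambda>n. r n - r (Suc n)) sums (r 0 - 0)"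
    by (rule telescope_sums')
  moreover have "r n - r (Suc n) = s n" for n
  proof -
    have "norm (q * Q ^ n) \<le> norm q * 1"
      unfolding norm_mult norm_power using Q by (intro mult_left_mono power_le_one) auto
    then have "norm (q * Q ^ n) < 1"
      using q by linarith
    from odd_min_series_rec [OF Q this]
    have V: "V n = q * Q ^ n * (2 * qpoch_inf (- (q * Q ^ Suc n)) Q - 1 / qpoch_inf (- Q) Q - V (Suc n))"
      by (simp add: V_def algebra_simps)
    \<comment> \<open>The squares in the exponents arise here: the prefactor
      \<open>q * Q ^ n\<close> contributes \<open>2 n + 1\<close>, the gap between consecutive
      squares.\<close>
    have e: "q ^ (Suc n)\<^sup>2 = q ^ n\<^sup>2 * (q * Q ^ n)"
      by (simp add: Q_def power_mult [symmetric] power_add [symmetric] power2_eq_square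
          flip: power_Suc) (simp add: algebra_simps power_add)
    show ?thesis
      unfolding r_def s_def e by (subst V) (simp add: algebra_simps)
  qed
  ultimately show ?thesis
    by (simp add: r_def V_def s_def Q_def)
qed

section \<open>Generating functions as unordered sums over finite sets of parts\<close>

lemma sum_power_Sum_Pow:
  fixes x :: "'a :: comm_semiring_1"
  assumes "finite A"
  shows "(\<Sum>S\<in>Pow A. x ^ \<Sum>S) = (\<Prod>k\<in>A. 1 + x ^ k)"
  unfolding add.commute [of 1]
  \<comment> \<open>When the product is multiplied out, \<open>S\<close> collects the
    \<open>k\<close> whose factor contributes \<open>x ^ k\<close>.\<close>
  by (subst prod_add [OF assms])
    (auto simp: power_sum finite_subset [OF _ assms] intro!: sum.cong)

text \<open>A finite family of sets lies in the power set of its union, where the sum becomes a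
  product of factors \<open>1 + norm q ^ k\<close>. By \<open>1 + x \<le> exp x\<close> and the
  geometric series this is bounded independently of the family.\<close>

lemma norm_summable_power_Sum:
  fixes q :: complex
  assumes "norm q < 1"
  shows "(\<lambda>S. norm (q ^ \<Sum>S)) summable_on Fpow UNIV"
proof (rule nonneg_bdd_above_summable_on)
  have "(\<Sum>S\<in>F. norm (q ^ \<Sum>S)) \<le> exp (1 / (1 - norm q))" if F: "F \<subseteq> Fpow UNIV" "finite F" for F
  proof -
    have fin: "finite (\<Union>F)"
      using F by (auto simp: Fpow_def)
    have "(\<Sum>S\<in>F. norm (q ^ \<Sum>S)) \<le> (\<Sum>S\<in>Pow (\<Union>F). norm q ^ \<Sum>S)"
      unfolding norm_power using fin by (intro sum_mono2) auto
    also have "\<dots> = (\<Prod>k\<in>\<Union>F. 1 + norm q ^ k)"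
      by (rule sum_power_Sum_Pow [OF fin])
    also have "\<dots> \<le> (\<Prod>k\<in>\<Union>F. exp (norm q ^ k))"
      by (intro prod_mono) auto
    also have "\<dots> = exp (\<Sum>k\<in>\<Union>F. norm q ^ k)"
      by (simp add: exp_sum fin)
    also have "(\<Sum>k\<in>\<Union>F. norm q ^ k) \<le> (\<Sum>k. norm q ^ k)"
      using assms fin by (intro sum_le_suminf summable_geometric) auto
    also have "\<dots> = 1 / (1 - norm q)"
      using assms by (simp add: suminf_geometric)
    finally show ?thesis by simp
  qed
  then show "bdd_above (sum (\<lambda>S. norm (q ^ \<Sum>S)) ` {F. F \<subseteq> Fpow UNIV \<and> finite F})"
    by (intro bdd_aboveI2) auto
qed simp

lemma summable_power_Sum:
  fixes q :: complex
  assumes "norm q < 1" and "\<And>S. S \<in> A \<Longrightarrow> finite S"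
  shows "(\<lambda>S. q ^ \<Sum>S) summable_on A"
  by (rule summable_on_subset_banach [OF abs_summable_summable [OF norm_summable_power_Sum]])
    (use assms in \<open>auto simp: Fpow_def\<close>)

text \<open>Euler's product for partitions into distinct parts that are at least \<open>k\<close>:
  the partial sums over \<open>Pow {k..<k + n}\<close> are the finite products.\<close>

lemma has_sum_power_Sum_Fpow:
  fixes q :: complex
  assumes "norm q < 1"
  shows "((\<lambda>S. q ^ \<Sum>S) has_sum qpoch_inf (- (q ^ k)) q) (Fpow {k..})"
proof -
  let ?f = "\<lambda>S. q ^ \<Sum>S"
  have "?f summable_on Fpow {k..}"
    using assms by (rule summable_power_Sum) (simp add: Fpow_def)
  then obtain L where L: "(?f has_sum L) (Fpow {k..})"
    by (auto simp: summable_on_def)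
  \<comment> \<open>These power sets eventually contain any given finite collection of finite sets,
    so the unordered sum can be computed as a limit along them.\<close>
  have "filterlim (\<lambda>n. Pow {k..<k + n}) (finite_subsets_at_top (Fpow {k..})) sequentially"
    unfolding filterlim_finite_subsets_at_top
  proof (intro allI impI)
    fix X assume X: "finite X \<and> X \<subseteq> Fpow {k..}"
    then have "finite (\<Union>X)"
      by (auto simp: Fpow_def)
    then obtain N where N: "\<And>i. i \<in> \<Union>X \<Longrightarrow> i < N"
      by (metis finite_nat_set_iff_bounded)
    have "X \<subseteq> Pow {k..<k + n}" if "n \<ge> N" for n
      using X N that by (fastforce simp: Fpow_def)
    then show "\<forall>\<^sub>F n in sequentially. finite (Pow {k..<k + n}) \<and>
        X \<subseteq> Pow {k..<k + n} \<and> Pow {k..<k + n} \<subseteq> Fpow {k..}"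
      unfolding eventually_sequentially
      by (intro exI [of _ N] allI impI conjI) (auto simp: Fpow_def intro: finite_subset)
  qed
  then have "(\<lambda>n. sum ?f (Pow {k..<k + n})) \<longlonglongrightarrow> L"
    using L unfolding has_sum_def by (rule filterlim_compose [rotated])
  moreover have "sum ?f (Pow {k..<k + n}) = qpoch (- (q ^ k)) q n" for n
  proof -
    have "sum ?f (Pow {k..<k + n}) = (\<Prod>i\<in>{k..<k + n}. 1 + q ^ i)"
      by (simp add: sum_power_Sum_Pow)
    also have "\<dots> = qpoch (- (q ^ k)) q n"
      unfolding qpoch_def by (induction n) (simp_all add: power_add)
    finally show ?thesis .
  qed
  ultimately have "L = qpoch_inf (- (q ^ k)) q"
    using LIMSEQ_unique [OF _ qpoch_tendsto [OF assms]] by simp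
  with L show ?thesis
    by simp
qed

text \<open>Used to group the sum over \<open>odd_min_sets\<close> in two ways: by the sum of the
  elements, giving the coefficients \<open>p_do\<close>, and by the minimum, giving
  \<open>V(q)\<close>.\<close>

lemma sums_fibres:
  fixes f :: "'a \<Rightarrow> complex" and g :: "'a \<Rightarrow> nat"
  assumes "f summable_on A"
  shows "(\<lambda>n. infsum f {x \<in> A. g x = n}) sums infsum f A"
proof -
  have bij: "bij_betw snd (SIGMA n:UNIV. {x \<in> A. g x = n}) A"
    by (rule bij_betwI [where g = "\<lambda>x. (g x, x)"]) auto
  have "((\<lambda>p. f (snd p)) has_sum infsum f A) (SIGMA n:UNIV. {x \<in> A. g x = n})"
    unfolding has_sum_reindex_bij_betw [OF bij] using assms by (rule has_sum_infsum)
  then have "((\<lambda>n. infsum f {x \<in> A. g x = n}) has_sum infsum f A) UNIV"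
    by (rule has_sum_SigmaD)
      (use assms in \<open>auto intro!: has_sum_infsum summable_on_subset_banach [OF assms]\<close>)
  then show ?thesis
    by (rule has_sum_imp_sums)
qed

text \<open>A partition into distinct parts is encoded as its set of parts. An odd minimum keeps 0
  out, so all elements are positive.\<close>

definition odd_min_sets :: "nat set set" where
  "odd_min_sets = {S. finite S \<and> S \<noteq> {} \<and> odd (Min S)}"

text \<open>A multiset without repetitions is determined by its support, so \<open>set_mset\<close>
  and \<open>mset_set\<close> are mutually inverse here.\<close>

lemma p_do_eq_card: "p_do n = card {S \<in> odd_min_sets. \<Sum>S = n}"
proof -
  have distinct: "mset_set (set_mset P) = P" if "\<forall>x. count P x \<le> 1" for P :: "nat multiset"
  proof (rule multiset_eqI)
    fix x
    show "count (mset_set (set_mset P)) x = count P x"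
      using that [rule_format, of x] count_greater_zero_iff [of P x]
      by (cases "x \<in># P") (auto simp: not_in_iff simp del: count_greater_zero_iff)
  qed
  have "bij_betw set_mset
      {P. is_partition P n \<and> (\<forall>x. count P x \<le> 1) \<and> P \<noteq> {#} \<and> odd (Min (set_mset P))}
      {S \<in> odd_min_sets. \<Sum>S = n}"
  proof (rule bij_betwI [where g = mset_set])
    show "mset_set \<in> {S \<in> odd_min_sets. \<Sum>S = n} \<rightarrow>
        {P. is_partition P n \<and> (\<forall>x. count P x \<le> 1) \<and> P \<noteq> {#} \<and> odd (Min (set_mset P))}"
    proof
      fix S assume "S \<in> {S \<in> odd_min_sets. \<Sum>S = n}"
      then have S: "finite S" "S \<noteq> {}" "odd (Min S)" "\<Sum>S = n"
        by (auto simp: odd_min_sets_def)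
      \<comment> \<open>Otherwise the minimum would be 0, which is even.\<close>
      have "0 \<notin> S"
        using S Min_le [of S 0] by auto
      with S show "mset_set S \<in> {P. is_partition P n \<and> (\<forall>x. count P x \<le> 1) \<and> P \<noteq> {#} \<and> odd (Min (set_mset P))}"
        by (auto simp: is_partition_def count_mset_set' mset_set_empty_iff sum_unfold_sum_mset)
    qed
  next
    show "set_mset \<in> {P. is_partition P n \<and> (\<forall>x. count P x \<le> 1) \<and> P \<noteq> {#} \<and> odd (Min (set_mset P))}
        \<rightarrow> {S \<in> odd_min_sets. \<Sum>S = n}"
    proof
      fix P :: "nat multiset"
      assume "P \<in> {P. is_partition P n \<and> (\<forall>x. count P x \<le> 1) \<and> P \<noteq> {#} \<and> odd (Min (set_mset P))}"
      then show "set_mset P \<in> {S \<in> odd_min_sets. \<Sum>S = n}"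
        using distinct [of P]
        by (simp add: odd_min_sets_def is_partition_def sum_unfold_sum_mset)
    qed
  qed (auto simp: distinct odd_min_sets_def)
  then show ?thesis
    unfolding p_do_def by (rule bij_betw_same_card)
qed

lemma p_do_generating_function:
  fixes q :: complex
  assumes q: "norm q < 1"
  shows "(\<lambda>n. of_nat (p_do (Suc n)) * q ^ Suc n) sums infsum (\<lambda>S. q ^ \<Sum>S) odd_min_sets"
proof -
  have "(\<lambda>S. q ^ \<Sum>S) summable_on odd_min_sets"
    using q by (rule summable_power_Sum) (simp add: odd_min_sets_def)
  from sums_fibres [OF this, of Sum]
  have *: "(\<lambda>n. infsum (\<lambda>S. q ^ \<Sum>S) {S \<in> odd_min_sets. \<Sum>S = n}) sums
    infsum (\<lambda>S. q ^ \<Sum>S) odd_min_sets" .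
  have "infsum (\<lambda>S. q ^ \<Sum>S) {S \<in> odd_min_sets. \<Sum>S = n} = of_nat (p_do n) * q ^ n" for n
  proof -
    \<comment> \<open>No element exceeds the sum \<open>n\<close>, so the fibre is finite and its
      constant summand \<open>q ^ n\<close> is counted \<open>p_do n\<close> times.\<close>
    have "{S \<in> odd_min_sets. \<Sum>S = n} \<subseteq> Pow {..n}"
      by (auto simp: odd_min_sets_def intro: member_le_sum [where f = "\<lambda>x::nat. x", simplified])
    then have "finite {S \<in> odd_min_sets. \<Sum>S = n}"
      by (rule finite_subset) simp
    moreover have "infsum (\<lambda>S. q ^ \<Sum>S) {S \<in> odd_min_sets. \<Sum>S = n} =
        infsum (\<lambda>S. q ^ n) {S \<in> odd_min_sets. \<Sum>S = n}"
      by (rule infsum_cong) simp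
    ultimately show ?thesis
      by (simp add: p_do_eq_card)
  qed
  \<comment> \<open>The grouped series starts at exponent 0, the claimed one at exponent 1.\<close>
  moreover have "p_do 0 = 0"
  proof -
    have "\<Sum>S \<noteq> 0" if "S \<in> odd_min_sets" for S
    proof
      assume "\<Sum>S = 0"
      with that Min_in [of S] have "Min S = 0"
        by (simp add: odd_min_sets_def)
      with that show False
        by (simp add: odd_min_sets_def)
    qed
    then have "{S \<in> odd_min_sets. \<Sum>S = 0} = {}"
      by blast
    then show ?thesis
      unfolding p_do_eq_card by (simp only: card.empty)
  qed
  ultimately show ?thesis
    using * sums_Suc_iff [of "\<lambda>n. of_nat (p_do n) * q ^ n"] by simp
qed

text \<open>Removing the minimum \<open>k\<close> costs a factor \<open>q ^ k\<close> and leaves an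
  arbitrary finite set of numbers above \<open>k\<close>.\<close>

lemma sum_over_Min_eq:
  fixes q :: complex
  assumes q: "norm q < 1"
  shows "infsum (\<lambda>S. q ^ \<Sum>S) {S. finite S \<and> S \<noteq> {} \<and> Min S = k} =
    q ^ k * qpoch_inf (- (q ^ Suc k)) q"
proof -
  have bij: "bij_betw (insert k) (Fpow {Suc k..}) {S. finite S \<and> S \<noteq> {} \<and> Min S = k}"
  proof (rule bij_betwI [where g = "\<lambda>S. S - {k}"])
    show "insert k \<in> Fpow {Suc k..} \<rightarrow> {S. finite S \<and> S \<noteq> {} \<and> Min S = k}"
      by (auto simp: Fpow_def intro!: Min_eqI)
    show "(\<lambda>S. S - {k}) \<in> {S. finite S \<and> S \<noteq> {} \<and> Min S = k} \<rightarrow> Fpow {Suc k..}"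
      by (auto simp: Fpow_def Suc_le_eq order.strict_iff_order)
    show "\<And>S. S \<in> {S. finite S \<and> S \<noteq> {} \<and> Min S = k} \<Longrightarrow> insert k (S - {k}) = S"
      using Min_in by blast
  qed (auto simp: Fpow_def)
  have "infsum (\<lambda>S. q ^ \<Sum>S) {S. finite S \<and> S \<noteq> {} \<and> Min S = k} =
      infsum (\<lambda>T. q ^ \<Sum>(insert k T)) (Fpow {Suc k..})"
    by (rule infsum_reindex_bij_betw [OF bij, symmetric])
  also have "\<dots> = infsum (\<lambda>T. q ^ k * q ^ \<Sum>T) (Fpow {Suc k..})"
  proof (rule infsum_cong)
    fix T assume "T \<in> Fpow {Suc k..}"
    then have "finite T" "k \<notin> T"
      by (auto simp: Fpow_def)
    then show "q ^ \<Sum>(insert k T) = q ^ k * q ^ \<Sum>T"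
      by (simp add: power_add)
  qed
  also have "\<dots> = q ^ k * qpoch_inf (- (q ^ Suc k)) q"
    by (rule infsumI has_sum_cmult_right has_sum_power_Sum_Fpow q)+
  finally show ?thesis .
qed

lemma odd_min_sets_sums:
  fixes q :: complex
  assumes q: "norm q < 1"
  shows "(\<lambda>m. q ^ (2 * m + 1) * qpoch_inf (- (q ^ (2 * m + 2))) q) sums
    infsum (\<lambda>S. q ^ \<Sum>S) odd_min_sets"
proof -
  have "(\<lambda>S. q ^ \<Sum>S) summable_on odd_min_sets"
    using q by (rule summable_power_Sum) (simp add: odd_min_sets_def)
  \<comment> \<open>Halving enumerates the odd minima \<open>2 * m + 1\<close> by all naturals
    \<open>m\<close>.\<close>
  moreover have "{S \<in> odd_min_sets. Min S div 2 = m} = {S. finite S \<and> S \<noteq> {} \<and> Min S = 2 * m + 1}" for m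
    by (auto simp: odd_min_sets_def elim: oddE)
  ultimately show ?thesis
    using sums_fibres [of "\<lambda>S. q ^ \<Sum>S" odd_min_sets "\<lambda>S. Min S div 2"]
    by (simp add: sum_over_Min_eq [OF q])
qed

text \<open>Beyond the smallest part \<open>2 m + 1\<close>, the even parts give a tail of
  \<open>qpoch_inf (- Q) Q\<close>, written as the full product over \<open>qpoch (- Q) Q m\<close>;
  the odd parts give the product in the numerator of \<open>V(q)\<close>.\<close>

lemma infsum_odd_min_sets:
  fixes q :: complex
  assumes q: "norm q < 1"
  shows "infsum (\<lambda>S. q ^ \<Sum>S) odd_min_sets =
    qpoch_inf (- q\<^sup>2) (q\<^sup>2) * odd_min_series (q\<^sup>2) q"
proof -
  define Q where "Q = q\<^sup>2"
  have Q: "norm Q < 1"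
    using q by (simp add: Q_def norm_power power_less_one_iff)
  have "q ^ (2 * m + 1) * qpoch_inf (- (q ^ (2 * m + 2))) q =
      qpoch_inf (- Q) Q * (q * Q ^ m * qpoch_inf (- (q * Q ^ Suc m)) Q / qpoch (- Q) Q m)" for m
  proof -
    have e: "q ^ (2 * m + 2) = Q * Q ^ m"
      by (simp add: Q_def power_add power_mult power2_eq_square)
    have "qpoch_inf (- (q ^ (2 * m + 2))) q = qpoch_inf (- Q * Q ^ m) Q * qpoch_inf (- (q * Q ^ Suc m)) Q"
      unfolding e qpoch_inf_double [OF q, of "- (Q * Q ^ m)"] Q_def [symmetric]
      by (simp add: mult_ac)
    also have "qpoch_inf (- Q * Q ^ m) Q = qpoch_inf (- Q) Q / qpoch (- Q) Q m"
      using qpoch_inf_split [OF Q, of "- Q" m] qpoch_nonzero [OF Q, of "- Q" m] Q by simp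
    finally show ?thesis
      by (simp add: Q_def power_mult)
  qed
  then show ?thesis
    using sums_unique [OF odd_min_sets_sums [OF q]] suminf_mult [OF summable_odd_min_series [OF Q q]]
    by (simp add: odd_min_series_def Q_def [symmetric])
qed

section \<open>Elimination of \<open>V(q)\<close> between its partition form and its alternating
  expansion\<close>

theorem theorem1p3:
  fixes q :: complex
  assumes "norm q < 1"
  shows "2 * qpoch_inf (- q) q * mock_psi (- q) =
    - (\<Sum>n. of_nat (p_do (Suc n)) * q ^ Suc n) + (\<Sum>k. (- 1) ^ Suc k * q ^ ((Suc k)\<^sup>2))"
proof -
  note q = assms
  define Q where "Q = q\<^sup>2"
  have Q: "norm Q < 1"
    using q by (simp add: Q_def norm_power power_less_one_iff)
  define E where "E = qpoch_inf (- Q) Q"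
  have E: "E \<noteq> 0"
    using qpoch_inf_nonzero [OF Q, of "- Q"] Q by (simp add: E_def)
  define c where "c n = (- 1) ^ Suc n * q ^ (Suc n)\<^sup>2" for n
  define P where "P n = qpoch_inf (- (q * Q ^ Suc n)) Q" for n
  have c: "summable c"
  proof (rule summable_comparison_test')
    show "summable (\<lambda>n. norm q ^ n)"
      using q by (intro summable_geometric) simp
    show "norm (c n) \<le> norm q ^ n" for n
    proof -
      have "n \<le> (Suc n)\<^sup>2"
        by (simp add: power2_eq_square)
      with q show ?thesis
        by (simp only: c_def norm_mult norm_power norm_minus_cancel norm_one power_one mult_1_left)
          (intro power_decreasing, simp_all)
    qed
  qed
  have V: "(\<lambda>n. c n * (1 / E - 2 * P n)) sums odd_min_series Q q"
    using odd_min_series_expansion [OF q] by (simp add: c_def P_def E_def Q_def)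
  \<comment> \<open>The square of \<open>Suc n\<close> has the parity of \<open>Suc n\<close>, which
    gives the sign; the finite denominator is the infinite product divided by its tail
    \<open>P n\<close>.\<close>
  have psi_term: "(- q) ^ (Suc n)\<^sup>2 / qpoch (- q) ((- q)\<^sup>2) (Suc n) = c n * P n / qpoch_inf (- q) Q" for n
  proof -
    have "(- q) ^ (Suc n)\<^sup>2 = c n"
      unfolding c_def by (subst power_minus) (simp add: power2_eq_square minus_one_power_iff)
    moreover have "qpoch_inf (- q) Q = qpoch (- q) Q (Suc n) * P n"
      using qpoch_inf_split [OF Q, of "- q" "Suc n"] by (simp add: P_def)
    moreover have "qpoch_inf (- q) Q \<noteq> 0"
      using qpoch_inf_nonzero [OF Q, of "- q"] q by simp
    ultimately show ?thesis
      by (auto simp: Q_def field_simps)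
  qed
  \<comment> \<open>Subtracting the expansion of \<open>V(q)\<close> from the theta series over
    \<open>E\<close> isolates \<open>c n * P n\<close>, the numerators of \<open>psi_term\<close>;
    its convergence follows from that of the other two series.\<close>
  have "(\<lambda>n. (c n / E - c n * (1 / E - 2 * P n)) / 2) sums ((suminf c / E - odd_min_series Q q) / 2)"
    by (intro sums_divide sums_diff summable_sums c V)
  moreover have "(c n / E - c n * (1 / E - 2 * P n)) / 2 = c n * P n" for n
    by (simp add: algebra_simps)
  ultimately have "(\<lambda>n. c n * P n / qpoch_inf (- q) Q) sums
      ((suminf c / E - odd_min_series Q q) / 2 / qpoch_inf (- q) Q)"
    by (simp only: sums_divide)
  then have "mock_psi (- q) = (suminf c / E - odd_min_series Q q) / 2 / qpoch_inf (- q) Q"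
    unfolding mock_psi_def psi_term by (rule sums_unique [symmetric])
  \<comment> \<open>The prefactor of the theorem clears exactly the two denominators
    \<open>qpoch_inf (- q) Q\<close> and \<open>E\<close>.\<close>
  moreover have "qpoch_inf (- q) q = qpoch_inf (- q) Q * E"
    using qpoch_inf_double [OF q, of "- q"] by (simp add: Q_def E_def power2_eq_square)
  moreover have "qpoch_inf (- q) Q \<noteq> 0"
    using qpoch_inf_nonzero [OF Q, of "- q"] q by simp
  ultimately have "2 * qpoch_inf (- q) q * mock_psi (- q) = - (E * odd_min_series Q q) + suminf c"
    using E by (simp add: field_simps)
  also have "E * odd_min_series Q q = (\<Sum>n. of_nat (p_do (Suc n)) * q ^ Suc n)"
    using sums_unique [OF p_do_generating_function [OF q]] infsum_odd_min_sets [OF q]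
    by (simp add: E_def Q_def)
  finally show ?thesis
    by (simp add: c_def [abs_def])
qed

end
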